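(* For a prime $p$ and integer $d \ge 1$, let $N_p(d)$ be the number of polynomials $f \in \mathbb{F}_p[x]$ of degree $d$ such that $L_p(f-g) \ge 2$ for every square-free polynomial $g \in \mathbb{F}_p[x]$. Then: (1) for any $d \ge 8$, $N_2(d) \ge 2^{d-8}$; (2) for any $d \ge 14$, $N_3(d) \ge 2 \cdot 3^{d-14}$; (3) for any prime $p \ge 5$, $N_p(15) \ge (p-2)p^5$, and for any integer $d \ge 16$, $N_p(d) \ge (p-1)p^{d-10}$.
   Context: $\mathbb{F}_p$ is the field with $p$ elements. For $h \in \mathbb{F}_p[x]$, its length $L_p(h)$ is obtained by representing each coefficient of $h$ by an integer in the interval $(-p/2, p/2]$ and summing the absolute values of these integers. A polynomial in $\mathbb{F}_p[x]$ is square-free if it is not divisible by the square of any polynomial of degree at least $1$. *)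

theory Defs
  imports "Berlekamp_Zassenhaus.Poly_Mod_Finite_Field"
begin

text \<open>
  The field with \<open>p\<close> elements is \<open>'p mod_ring\<close>, where \<open>'p\<close> is a type of prime cardinality
  \<open>p = CARD('p)\<close>. Square-freeness is the library's \<^const>\<open>square_free\<close>; its condition that
  the polynomial be nonzero is redundant over a field, since the zero polynomial is
  divisible by every square.
\<close>

text \<open>
  The representative of a residue class in \<open>(-p/2, p/2]\<close>: the values of
  \<^const>\<open>to_int_mod_ring\<close> lie in \<open>{0..<p}\<close>, and those above \<open>p/2\<close> are shifted by \<open>-p\<close>.
\<close>

definition centered_rep :: "'p :: prime_card mod_ring \<Rightarrow> int" where
  "centered_rep c =
     (if 2 * to_int_mod_ring c \<le> int CARD('p) then to_int_mod_ring c
      else to_int_mod_ring c - int CARD('p))"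

lemma to_int_mod_ring_bounds:
  fixes c :: "'p :: finite mod_ring"
  shows "0 \<le> to_int_mod_ring c" and "to_int_mod_ring c < int CARD('p)"
  using range_to_int_mod_ring[where 'a = 'p] by (metis atLeastLessThan_iff rangeI)+

lemma centered_rep_eq_iff:
  fixes c :: "'p :: prime_card mod_ring"
  shows "centered_rep c = k \<longleftrightarrow>
    of_int k = c \<and> - real CARD('p) / 2 < real_of_int k \<and> real_of_int k \<le> real CARD('p) / 2"
proof -
  have *: "of_int (to_int_mod_ring c) = c"
    by (simp add: of_int_of_int_mod_ring of_int_mod_ring_to_int_mod_ring)
  have card0: "of_int (int CARD('p)) = (0 :: 'p mod_ring)"
    unfolding of_int_of_int_mod_ring by transfer simp
  have rep: "of_int (centered_rep c) = c"
    using * card0 by (simp add: centered_rep_def)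
  have bounds: "- int CARD('p) < 2 * centered_rep c" "2 * centered_rep c \<le> int CARD('p)"
    using to_int_mod_ring_bounds[of c] by (auto simp: centered_rep_def)
  have real_iff: "- real CARD('p) / 2 < real_of_int j \<and> real_of_int j \<le> real CARD('p) / 2 \<longleftrightarrow>
      - int CARD('p) < 2 * j \<and> 2 * j \<le> int CARD('p)" for j
    by linarith
  have "centered_rep c = k"
    if k: "of_int k = c" "- int CARD('p) < 2 * k" "2 * k \<le> int CARD('p)"
  proof -
    have "(of_int k :: 'p mod_ring) = of_int (centered_rep c)"
      using k rep by simp
    hence "k mod int CARD('p) = centered_rep c mod int CARD('p)"
      unfolding of_int_of_int_mod_ring by transfer
    then obtain q where q: "centered_rep c - k = int CARD('p) * q"
      by (metis mod_eq_dvd_iff dvdE)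
    have "\<bar>centered_rep c - k\<bar> < int CARD('p)"
      using k bounds by linarith
    hence "int CARD('p) * \<bar>q\<bar> < int CARD('p) * 1"
      by (simp add: q abs_mult)
    hence "q = 0"
      by (subst (asm) mult_less_cancel_left) auto
    thus ?thesis using q by simp
  qed
  thus ?thesis using rep bounds real_iff by metis
qed

definition poly_length :: "'p :: prime_card mod_ring poly \<Rightarrow> int" where
  "poly_length h = (\<Sum>i\<le>degree h. \<bar>centered_rep (coeff h i)\<bar>)"

definition far_from_square_free :: "'p :: prime_card mod_ring poly \<Rightarrow> bool" where
  "far_from_square_free f \<longleftrightarrow> (\<forall>g. square_free g \<longrightarrow> poly_length (f - g) \<ge> 2)"

definition num_far :: "'p :: prime_card itself \<Rightarrow> nat \<Rightarrow> nat" where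
  "num_far _ d = card {f :: 'p mod_ring poly. degree f = d \<and> far_from_square_free f}"

lemma finite_far_from_square_free:
  "finite {f :: 'p :: prime_card mod_ring poly. degree f = d \<and> far_from_square_free f}"
proof (rule finite_subset)
  show "{f :: 'p mod_ring poly. degree f = d \<and> far_from_square_free f} \<subseteq>
      Poly ` {xs. set xs \<subseteq> UNIV \<and> length xs \<le> Suc d}"
  proof
    fix f :: "'p mod_ring poly"
    assume "f \<in> {f. degree f = d \<and> far_from_square_free f}"
    hence "length (coeffs f) \<le> Suc d"
      by (cases "f = 0") (auto simp: length_coeffs)
    thus "f \<in> Poly ` {xs. set xs \<subseteq> UNIV \<and> length xs \<le> Suc d}"
      by (intro image_eqI[where x = "coeffs f"]) auto
  qed
  show "finite (Poly ` {xs :: 'p mod_ring list. set xs \<subseteq> UNIV \<and> length xs \<le> Suc d})"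
    by (intro finite_imageI finite_lists_length_le) simp
qed

end

theory Submission
  imports Defs "Berlekamp_Zassenhaus.Chinese_Remainder_Poly"
begin

text \<open>
  A polynomial at distance at most 1 from \<open>f\<close> is \<open>f\<close> or \<open>f \<plusminus> x\<^sup>k\<close>. If \<open>x\<^sup>2\<close> divides \<open>f\<close>, then
  it divides \<open>f\<close> and all \<open>f \<plusminus> x\<^sup>k\<close> with \<open>k \<ge> 2\<close>, so only the at most four polynomials
  \<open>f \<plusminus> 1\<close> and \<open>f \<plusminus> x\<close> remain. Prescribing a square divisor for each of them, with moduli of
  lowest possible degree coprime to each other and to \<open>x\<close>, determines \<open>f\<close> modulo a polynomial
  whose degree is 8 for \<open>p = 2\<close>, 14 for \<open>p = 3\<close> and 10 for \<open>p \<ge> 5\<close>.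
\<close>

text \<open>The leading coefficient of a nonzero \<open>h\<close> already contributes at least 1, so
  a length below 2 makes that contribution exactly 1 and leaves nothing for the lower coefficients.
  The value \<open>c = 0\<close> covers \<open>h = 0\<close>.\<close>

lemma poly_length_less_2_imp_monom:
  fixes h :: "'p :: prime_card mod_ring poly"
  assumes "poly_length h < 2"
  obtains c k where "h = monom c k" "c \<in> {0, 1, -1}"
proof -
  define a where "a i = \<bar>centered_rep (coeff h i)\<bar>" for i
  have zero: "c = 0" if "centered_rep c = 0" for c :: "'p mod_ring"
    using that centered_rep_eq_iff[of c 0] by simp
  show thesis
  proof (cases "h = 0")
    case True
    then show thesis using that[of 0 0] by simp
  next
    case False
    let ?n = "degree h"
    have lead: "a ?n \<ge> 1"
      using False zero[of "coeff h ?n"] unfolding a_def by fastforce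
    have "{..?n} = insert ?n {..<?n}"
      by auto
    then have "a ?n + (\<Sum>i<?n. a i) < 2"
      using assms by (simp add: poly_length_def a_def)
    moreover have nonneg: "(\<Sum>i<?n. a i) \<ge> 0"
      by (intro sum_nonneg) (simp add: a_def)
    ultimately have sum0: "(\<Sum>i<?n. a i) = 0" and "a ?n = 1"
      using lead by linarith+
    then have "centered_rep (coeff h ?n) = 1 \<or> centered_rep (coeff h ?n) = -1"
      by (auto simp: a_def)
    then have "coeff h ?n \<in> {0, 1, -1}"
      using centered_rep_eq_iff[of "coeff h ?n" 1] centered_rep_eq_iff[of "coeff h ?n" "-1"] by auto
    moreover have "coeff h i = 0" if "i < ?n" for i
    proof -
      have "a i = 0"
        using sum0 that by (subst (asm) sum_nonneg_eq_0_iff) (auto simp: a_def)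
      then show ?thesis using zero by (simp add: a_def)
    qed
    then have "h = monom (coeff h ?n) ?n"
      by (intro poly_eqI) (metis coeff_eq_0 coeff_monom linorder_neqE_nat)
    ultimately show thesis using that by blast
  qed
qed

text \<open>Induction on the degree, splitting off the constant coefficient with
  \<open>pCons\<close>. The condition \<open>q \<noteq> 0\<close> keeps out the zero polynomial,
  whose degree is 0 by convention and would spoil the count for \<open>m = 0\<close>.\<close>

lemma card_polys_of_degree:
  "card {q :: 'a :: {finite, zero} poly. degree q = m \<and> q \<noteq> 0} = (CARD('a) - 1) * CARD('a) ^ m"
proof (induction m)
  case 0
  have "bij_betw (\<lambda>c :: 'a. [:c:]) (UNIV - {0}) {q. degree q = 0 \<and> q \<noteq> 0}"
    by (rule bij_betw_byWitness[where f' = "\<lambda>q. coeff q 0"])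
      (auto dest: degree0_coeffs)
  from bij_betw_same_card[OF this] show ?case
    by (simp add: card_Diff_singleton)
next
  case (Suc m)
  let ?S = "{q :: 'a poly. degree q = m \<and> q \<noteq> 0}"
  have "bij_betw (\<lambda>(c, q). pCons c q) (UNIV \<times> ?S) {q. degree q = Suc m \<and> q \<noteq> 0}"
    unfolding bij_betw_def
  proof (intro conjI equalityI subsetI)
    show "inj_on (\<lambda>(c, q). pCons c q) (UNIV \<times> ?S)"
      by (rule inj_onI) (simp add: case_prod_beta prod_eq_iff)
    fix q :: "'a poly"
    show "q \<in> {q. degree q = Suc m \<and> q \<noteq> 0}" if "q \<in> (\<lambda>(c, q). pCons c q) ` (UNIV \<times> ?S)"
      using that by fastforce
    show "q \<in> (\<lambda>(c, q). pCons c q) ` (UNIV \<times> ?S)" if "q \<in> {q. degree q = Suc m \<and> q \<noteq> 0}"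
      using that by (cases q) (auto split: if_splits)
  qed
  from bij_betw_same_card[OF this]
  have "card {q :: 'a poly. degree q = Suc m \<and> q \<noteq> 0} = CARD('a) * card ?S"
    by (simp add: card_cartesian_product)
  then show ?case
    by (simp only: Suc.IH power_Suc mult.left_commute)
qed

text \<open>Adding the remainder \<open>u mod m\<close> to \<open>m * q\<close> puts it in the class
  of \<open>u\<close> without changing its degree, so distinct nonzero quotients of degree
  \<open>d - degree m\<close> give distinct members.\<close>

lemma card_polys_in_residue_class:
  fixes u m :: "'a :: {finite, field} poly"
  assumes deg: "0 < degree m" "degree m \<le> d"
    and fin: "finite {f. degree f = d \<and> m dvd f - u}"
  shows "(CARD('a) - 1) * CARD('a) ^ (d - degree m) \<le> card {f. degree f = d \<and> m dvd f - u}"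
proof -
  let ?Q = "{q :: 'a poly. degree q = d - degree m \<and> q \<noteq> 0}"
  let ?f = "\<lambda>q. m * q + u mod m"
  have "m \<noteq> 0" using deg by auto
  \<comment> \<open>Positivity of \<open>degree m\<close> covers a zero remainder, which has degree
    0.\<close>
  have "degree (u mod m) < degree m"
    using \<open>m \<noteq> 0\<close> deg by (metis degree_mod_less' degree_0)
  then have "degree (?f q) = d" if "q \<in> ?Q" for q
    using that \<open>m \<noteq> 0\<close> deg by (subst degree_add_eq_left) (auto simp: degree_mult_eq)
  moreover have "m dvd ?f q - u" for q
    by (metis add_diff_eq dvd_add dvd_minus_mod dvd_minus_iff dvd_triv_left minus_diff_eq)
  ultimately have "?f ` ?Q \<subseteq> {f. degree f = d \<and> m dvd f - u}" by auto
  moreover have "inj_on ?f ?Q"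
    using \<open>m \<noteq> 0\<close> by (auto intro: inj_onI)
  ultimately have "card ?Q \<le> card {f. degree f = d \<and> m dvd f - u}"
    using fin card_inj_on_le by blast
  then show ?thesis by (simp add: card_polys_of_degree)
qed

text \<open>
  A pair \<open>(h, q)\<close> stands for the requirement that \<open>q\<^sup>2\<close> divides \<open>f - h\<close>.
\<close>

lemma num_far_ge:
  fixes ps :: "('p :: prime_card mod_ring poly \<times> 'p mod_ring poly) list"
  assumes zero: "(0, [:0, 1:]) \<in> set ps"
    and mono: "\<And>c k. c \<in> {1, -1} \<Longrightarrow> k < 2 \<Longrightarrow> monom c k \<in> fst ` set ps"
    and cop: "sorted_wrt (\<lambda>x y. Rings.coprime (snd x) (snd y)) ps"
    and pos: "\<And>x. x \<in> set ps \<Longrightarrow> degree (snd x) > 0"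
    and N: "(\<Sum>x\<leftarrow>ps. 2 * degree (snd x)) = N" and "N \<le> d"
  shows "(CARD('p) - 1) * CARD('p) ^ (d - N) \<le> num_far TYPE('p) d"
proof -
  let ?I = "{..<length ps}"
  let ?q = "\<lambda>i. snd (ps ! i) ^ 2"
  define m where "m = prod ?q ?I"
  have cop': "Rings.coprime (?q i) (?q j)" if "i \<in> ?I" "j \<in> ?I" "i \<noteq> j" for i j
  proof -
    have "Rings.coprime (snd (ps ! i)) (snd (ps ! j))"
      using that(3)
    proof (cases i j rule: linorder_cases)
      case less
      then show ?thesis using cop that by (simp add: sorted_wrt_iff_nth_less)
    next
      case greater
      then have "Rings.coprime (snd (ps ! j)) (snd (ps ! i))"
        using cop that by (simp add: sorted_wrt_iff_nth_less)
      then show ?thesis by (simp add: Rings.coprime_commute)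
    qed simp
    then show ?thesis by simp
  qed
  \<comment> \<open>One class modulo \<open>m\<close> meets all requirements at once, and each of
    its members will turn out to be far from square-free.\<close>
  then obtain u where u: "\<And>i. i \<in> ?I \<Longrightarrow> [u = fst (ps ! i)] (mod ?q i)"
    using chinese_remainder_poly[of ?I ?q "\<lambda>i. fst (ps ! i)"] by auto
  have nz: "?q i \<noteq> 0" if "i \<in> ?I" for i
    using pos[of "ps ! i"] that by force
  have deg_m: "degree m = N"
  proof -
    have "degree m = (\<Sum>i\<in>?I. degree (?q i))"
      unfolding m_def using nz by (intro degree_prod_eq_sum_degree) auto
    also have "\<dots> = (\<Sum>i<length ps. 2 * degree (snd (ps ! i)))"
      using nz by (intro sum.cong) (auto simp: degree_power_eq)
    also have "\<dots> = N"
      by (simp add: sum_list_sum_nth atLeast0LessThan flip: N)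
    finally show ?thesis .
  qed
  \<comment> \<open>The pair with modulus x alone contributes 2 to the sum.\<close>
  have "N > 0"
  proof -
    have "2 * degree [:0, 1 :: 'p mod_ring:] \<in> set (map (\<lambda>x. 2 * degree (snd x)) ps)"
      using zero by force
    from member_le_sum_list[OF this] show ?thesis
      using N by simp
  qed
  have far: "far_from_square_free f" if f: "m dvd f - u" for f
    unfolding far_from_square_free_def
  proof (intro allI impI)
    fix g :: "'p mod_ring poly"
    assume sf: "square_free g"
    show "poly_length (f - g) \<ge> 2"
    proof (rule ccontr)
      assume "\<not> ?thesis"
      then have "poly_length (f - g) < 2" by simp
      then obtain c k where ck: "f - g = monom c k" "c \<in> {0, 1, -1}"
        by (rule poly_length_less_2_imp_monom)
      have g: "g = f - monom c k"
        by (simp flip: ck(1))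
      have key: "q ^ 2 dvd f - h" if "(h, q) \<in> set ps" for h q
      proof -
        from that obtain i where i: "i \<in> ?I" "ps ! i = (h, q)"
          by (metis in_set_conv_nth lessThan_iff)
        then have "?q i dvd m"
          unfolding m_def by (intro dvd_prodI) auto
        then have "q ^ 2 dvd f - u"
          using f i by (auto intro: dvd_trans)
        moreover have "q ^ 2 dvd u - h"
          using u[OF i(1)] i(2) by (simp add: cong_iff_dvd_diff)
        ultimately have "q ^ 2 dvd (f - u) + (u - h)" by (rule dvd_add)
        then show ?thesis by simp
      qed
      have "\<exists>q. degree q > 0 \<and> q * q dvd g"
      \<comment> \<open>In the first case x^2 divides both \<open>f\<close> and the monomial;
        otherwise the monomial is 1, -1, x or -x and has its own pair in \<open>ps\<close>.\<close>
      proof (cases "c = 0 \<or> k \<ge> 2")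
        case True
        have "[:0, 1:] ^ 2 dvd monom c k"
        proof (cases "c = 0")
          case False
          with True have "[:0, 1:] ^ 2 dvd [:0, 1:] ^ k"
            by (intro le_imp_power_dvd) simp
          then show ?thesis unfolding monom_altdef by (rule dvd_smult)
        qed simp
        moreover have "[:0, 1:] ^ 2 dvd f"
          using key[OF zero] by simp
        ultimately have "[:0, 1:] ^ 2 dvd f - monom c k" by (rule dvd_diff[rotated])
        moreover have "degree [:0, 1 :: 'p mod_ring:] > 0" by simp
        ultimately show ?thesis unfolding g power2_eq_square by blast
      next
        case False
        then have "monom c k \<in> fst ` set ps"
          using ck(2) by (intro mono) auto
        then obtain q where "(monom c k, q) \<in> set ps" by auto
        from key[OF this] pos[OF this] show ?thesis
          unfolding g power2_eq_square by auto
      qed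
      then show False
        using sf unfolding square_free_def by blast
    qed
  qed
  have sub: "{f. degree f = d \<and> m dvd f - u} \<subseteq> {f. degree f = d \<and> far_from_square_free f}"
    using far by auto
  have "(CARD('p) - 1) * CARD('p) ^ (d - N) \<le> card {f. degree f = d \<and> m dvd f - u}"
    using card_polys_in_residue_class[of m d u] deg_m \<open>N > 0\<close> \<open>N \<le> d\<close>
      finite_subset[OF sub finite_far_from_square_free] by simp
  also have "\<dots> \<le> num_far TYPE('p) d"
    unfolding num_far_def by (intro card_mono sub finite_far_from_square_free)
  finally show ?thesis .
qed

text \<open>Division of \<open>q\<close> by x + a leaves the constant \<open>poly q (- a)\<close>, a
  unit. The form \<open>pCons a 1\<close> is what simplification with \<open>pCons_one\<close> makes
  of \<open>[:a, 1:]\<close>.\<close>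

lemma coprime_linear_poly_left:
  fixes q :: "'a :: field poly"
  assumes "poly q (- a) \<noteq> 0"
  shows "Rings.coprime (pCons a 1) q"
proof (rule Rings.coprimeI)
  fix c assume "c dvd pCons a 1" "c dvd q"
  then have "c dvd q - pCons a 1 * synthetic_div q (- a)"
    by (intro dvd_diff dvd_mult2)
  also have "q - pCons a 1 * synthetic_div q (- a) = [:poly q (- a):]"
    using synthetic_div_correct'[of "- a" q] by (simp add: algebra_simps)
  finally show "is_unit c"
    using assms by (metis dvd_trans is_unit_const_poly_iff dvd_field_iff)
qed

lemma of_nat_mod_ring_eq_0_iff:
  "of_nat n = (0 :: 'p :: prime_card mod_ring) \<longleftrightarrow> CARD('p) dvd n"
proof
  show "CARD('p) dvd n" if "of_nat n = (0 :: 'p mod_ring)"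
    using that by (rule of_nat_0_mod_ring_dvd)
  show "of_nat n = (0 :: 'p mod_ring)" if "CARD('p) dvd n"
    using that by auto
qed

lemma numeral_mod_ring_eq_0_iff:
  "numeral n = (0 :: 'p :: prime_card mod_ring) \<longleftrightarrow> CARD('p) dvd numeral n"
  using of_nat_mod_ring_eq_0_iff[of "numeral n"] by simp

text \<open>Signs collapse, so two moduli besides x suffice: the other linear polynomial and the
  irreducible quadratic. The degree is 2(1 + 1 + 2) = 8.\<close>

lemma num_far_char_2:
  assumes p: "CARD('p :: prime_card) = 2" and "d \<ge> 8"
  shows "2 ^ (d - 8) \<le> num_far TYPE('p) d"
proof -
  \<comment> \<open>Here 3 is the value of x^2 + x + 1 at -1 = 1, which gives coprimality to x +
    1.\<close>
  have "(2 :: 'p mod_ring) = 0" and ne: "(3 :: 'p mod_ring) \<noteq> 0"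
    using p by (simp_all add: numeral_mod_ring_eq_0_iff)
  then have neg: "- 1 = (1 :: 'p mod_ring)"
    by (simp add: neg_eq_iff_add_eq_0)
  have "(CARD('p) - 1) * CARD('p) ^ (d - 8) \<le> num_far TYPE('p) d"
    using \<open>d \<ge> 8\<close> ne
    by (intro num_far_ge[of "[(0, [:0, 1:]), (monom 1 0, [:1, 1:]), (monom 1 1, [:1, 1, 1:])]"])
      (auto simp: less_2_cases_iff neg intro!: coprime_linear_poly_left)
  then show ?thesis by (simp add: p)
qed

text \<open>Only three monic linear polynomials exist, so two of the five moduli are irreducible
  quadratics, and the degree is 2(1 + 1 + 1 + 2 + 2) = 14. Listing the linear ones first leaves
  \<open>?a\<close> and \<open>?b\<close> as the only pair not settled by evaluation at a
  root.\<close>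

lemma num_far_char_3:
  assumes p: "CARD('p :: prime_card) = 3" and "d \<ge> 14"
  shows "2 * 3 ^ (d - 14) \<le> num_far TYPE('p) d"
proof -
  have ne: "(2 :: 'p mod_ring) \<noteq> 0" "(5 :: 'p mod_ring) \<noteq> 0"
    using p by (simp_all add: numeral_mod_ring_eq_0_iff)
  let ?a = "[:1, 0, 1 :: 'p mod_ring:]" and ?b = "[:- 1, 1, 1 :: 'p mod_ring:]"
  have cop: "Rings.coprime ?a ?b"
  proof (rule Rings.coprimeI)
    fix c assume "c dvd ?a" "c dvd ?b"
    \<comment> \<open>A Bezout identity that holds already over the integers, with the constant 5
      invertible modulo 3.\<close>
    then have "c dvd [:3, 1:] * ?a - [:2, 1:] * ?b"
      by (intro dvd_diff dvd_mult)
    also have "[:3, 1:] * ?a - [:2, 1:] * ?b = [:5:]" by (simp add: one_pCons del: pCons_one)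
    finally show "is_unit c"
      using ne by (metis dvd_trans is_unit_const_poly_iff dvd_field_iff)
  qed
  have "(CARD('p) - 1) * CARD('p) ^ (d - 14) \<le> num_far TYPE('p) d"
    using \<open>d \<ge> 14\<close> ne cop
    by (intro num_far_ge[of "[(0, [:0, 1:]), (monom 1 0, [:- 1, 1:]), (monom (- 1) 0, [:1, 1:]),
      (monom 1 1, ?a), (monom (- 1) 1, ?b)]"])
      (auto simp: less_2_cases_iff intro!: coprime_linear_poly_left)
  then show ?thesis by (simp add: p)
qed

text \<open>The five linear polynomials x, x + 1, ..., x + 4 are pairwise coprime because the
  differences 1 to 4 of their constant terms are nonzero modulo \<open>p\<close>. The degree is 2 *
  5 = 10.\<close>

lemma num_far_char_ge_5:
  assumes p: "CARD('p :: prime_card) \<ge> 5" and "d \<ge> 10"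
  shows "(CARD('p) - 1) * CARD('p) ^ (d - 10) \<le> num_far TYPE('p) d"
proof -
  have "(2 :: 'p mod_ring) \<noteq> 0" "(3 :: 'p mod_ring) \<noteq> 0" "(4 :: 'p mod_ring) \<noteq> 0"
    using p by (auto simp: numeral_mod_ring_eq_0_iff dest: dvd_imp_le)
  then show ?thesis
    using \<open>d \<ge> 10\<close>
    by (intro num_far_ge[of "[(0, [:0, 1:]), (monom 1 0, [:1, 1:]), (monom (- 1) 0, [:2, 1:]),
      (monom 1 1, [:3, 1:]), (monom (- 1) 1, [:4, 1:])]"])
      (auto simp: less_2_cases_iff intro!: coprime_linear_poly_left)
qed

theorem theorem6p1:
  shows "(CARD('p :: prime_card) = 2 \<longrightarrow>
            (\<forall>d\<ge>8. num_far TYPE('p) d \<ge> 2 ^ (d - 8))) \<and>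
         (CARD('p) = 3 \<longrightarrow>
            (\<forall>d\<ge>14. num_far TYPE('p) d \<ge> 2 * 3 ^ (d - 14))) \<and>
         (CARD('p) \<ge> 5 \<longrightarrow>
            num_far TYPE('p) 15 \<ge> (CARD('p) - 2) * CARD('p) ^ 5 \<and>
            (\<forall>d\<ge>16. num_far TYPE('p) d \<ge> (CARD('p) - 1) * CARD('p) ^ (d - 10)))"
proof -
  have "(CARD('p) - 2) * CARD('p) ^ 5 \<le> num_far TYPE('p) 15" if "CARD('p) \<ge> 5"
  proof -
    \<comment> \<open>Degree 15 falls under the general bound with exponent 15 - 10 = 5, which has
      the larger factor \<open>CARD('p) - 1\<close>.\<close>
    have "(CARD('p) - 2) * CARD('p) ^ 5 \<le> (CARD('p) - 1) * CARD('p) ^ 5"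
      by (intro mult_right_mono) auto
    also have "\<dots> \<le> num_far TYPE('p) 15"
      using num_far_char_ge_5[OF that, of 15] by simp
    finally show ?thesis .
  qed
  then show ?thesis
    using num_far_char_2[where 'p = 'p] num_far_char_3[where 'p = 'p]
      num_far_char_ge_5[where 'p = 'p] by auto
qed

end
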